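(* Let $m,p,q,k$ be integers with $m,p,q,k>1$. Then $$\sum_{n=1}^\infty\frac{\zeta(m)\zeta(p)-\zeta_n(m)\zeta_n(p)}{n^k}=\zeta(p)\zeta(m,k)+\zeta(p,k,m)+\zeta(p,m+k),$$ $$\sum_{n=1}^\infty\frac{\zeta_n(m)\zeta(p)\zeta(q)-\zeta(m)\zeta_n(p)\zeta_n(q)}{n^k}=\zeta(m)\big[\zeta(p)\zeta(q,k)+\zeta(p,k,q)+\zeta(p,q+k)\big]-\zeta(p)\zeta(q)\zeta(m,k),$$ $$\sum_{n=1}^\infty\frac{\zeta(m)\zeta_n(p)\zeta_n(q)-\zeta(p)\zeta_n(m)\zeta_n(q)}{n^k}=\zeta(p)\big[\zeta(m,k,q)+\zeta(m,q+k)\big]-\zeta(m)\big[\zeta(p,k,q)+\zeta(p,q+k)\big].$$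
   Context: $\zeta(s)=\sum_{j\ge1}j^{-s}$, $\zeta_n(s)=\sum_{j=1}^n j^{-s}$; multiple zeta value $\zeta(s_1,\dots,s_r)=\sum_{n_1>n_2>\cdots>n_r\ge1}n_1^{-s_1}\cdots n_r^{-s_r}$. *)

theory Defs
  imports "HOL-Analysis.Analysis"
begin

definition zeta :: "nat \<Rightarrow> real" where
  "zeta s = (\<Sum>j. 1 / real (Suc j) ^ s)"

definition zeta_partial :: "nat \<Rightarrow> nat \<Rightarrow> real" where
  "zeta_partial n s = (\<Sum>j=1..n. 1 / real j ^ s)"

definition mzv_indices :: "nat \<Rightarrow> nat list set" where
  "mzv_indices r = {ns. length ns = r \<and> sorted_wrt (>) ns \<and> (\<forall>n\<in>set ns. n \<ge> 1)}"

text \<open>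
  The multiple zeta value of a list of exponents, with the largest summation index
  paired with the first exponent: \<open>mzv [s\<^sub>1, \<dots>, s\<^sub>r]\<close> is the sum over
  \<open>n\<^sub>1 > \<dots> > n\<^sub>r \<ge> 1\<close>. All terms are nonnegative, so the unordered sum agrees with every
  iterated one; it converges if all exponents are positive and the first is at least 2.
  Otherwise it may diverge, in which case \<open>infsum\<close> returns the value 0.
\<close>

definition mzv :: "nat list \<Rightarrow> real" where
  "mzv ss = (\<Sum>\<^sub>\<infinity>ns\<in>mzv_indices (length ss). \<Prod>i<length ss. 1 / real (ns ! i) ^ (ss ! i))"

end

theory Submission
  imports Defs
begin

text \<open>
  Put \<open>R\<^sub>n(s) = \<zeta>(s) - \<zeta>\<^sub>n(s)\<close>, the sum of \<open>j\<^sup>-\<^sup>s\<close> over \<open>j > n\<close>. Sorting the multiple sums by the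
  summation index with exponent \<open>k\<close> gives \<open>\<Sum>\<^sub>n R\<^sub>n(s) / n\<^sup>k = \<zeta>(s,k)\<close> and
  \<open>\<Sum>\<^sub>n R\<^sub>n(s) \<zeta>\<^sub>n(t) / n\<^sup>k = \<zeta>(s,k,t) + \<zeta>(s,k+t)\<close>. Each of the three numerators is a linear
  combination of \<open>R\<^sub>n\<close> and \<open>R\<^sub>n \<zeta>\<^sub>n\<close> for the exponents involved; for example, the first is
  \<open>\<zeta>(p) R\<^sub>n(m) + \<zeta>\<^sub>n(m) R\<^sub>n(p)\<close>.
\<close>

lemma zeta_sums:
  assumes "s > 1"
  shows "(\<lambda>j. 1 / real (Suc j) ^ s) sums zeta s"
proof -
  have "summable (\<lambda>j. inverse (real j ^ s))"
    using inverse_power_summable[of s, where ?'a = real] assms by simp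
  hence "summable (\<lambda>j. inverse (real (Suc j) ^ s))"
    by (subst summable_Suc_iff)
  thus ?thesis
    unfolding zeta_def by (simp add: summable_sums inverse_eq_divide)
qed

lemma zeta_partial_eq_lessThan:
  "zeta_partial n s = (\<Sum>j<n. 1 / real (Suc j) ^ s)"
  unfolding zeta_partial_def
  by (rule sum.reindex_bij_witness[of _ Suc "\<lambda>j. j - 1"]) auto

lemma zeta_partial_nonneg: "zeta_partial n s \<ge> 0"
  unfolding zeta_partial_def by (intro sum_nonneg) auto

lemma zeta_partial_le_zeta:
  assumes "s > 1"
  shows "zeta_partial n s \<le> zeta s"
  using zeta_sums[OF assms] unfolding zeta_partial_eq_lessThan zeta_def
  by (intro sum_le_suminf) (auto simp: sums_iff)

lemma zeta_nonneg: "s > 1 \<Longrightarrow> zeta s \<ge> 0"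
  using zeta_partial_le_zeta[of s 0] by (simp add: zeta_partial_def)

text \<open>The tail over \<open>j > n\<close> is indexed by the gap \<open>i = j - n - 1\<close>.
  Nonnegative terms turn the ordered sum into an unordered one, as the multiple sums
  require.\<close>

lemma zeta_tail_has_sum:
  assumes "s > 1"
  shows "((\<lambda>i. 1 / real (Suc (i + n)) ^ s) has_sum (zeta s - zeta_partial n s)) UNIV"
  using sums_split_initial_segment[OF zeta_sums[OF assms], of n]
  unfolding zeta_partial_eq_lessThan by (intro sums_nonneg_imp_has_sum) auto

text \<open>Comparison with C times the series for \<zeta>(k). It gives convergence of the outer
  sums over the middle index, where \<open>g\<close> is a tail or a partial sum times a
  tail.\<close>

lemma summable_on_bounded_over_power:
  fixes g :: "nat \<Rightarrow> real"
  assumes "k > 1" and "\<And>n. 0 \<le> g n" and "\<And>n. g n \<le> C"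
  shows "(\<lambda>n. g n / real (Suc n) ^ k) summable_on UNIV"
proof (rule summable_nonneg_imp_summable_on)
  have "summable (\<lambda>n. C * (1 / real (Suc n) ^ k))"
    using zeta_sums[OF assms(1)] by (intro summable_mult) (simp add: sums_iff)
  thus "summable (\<lambda>n. g n / real (Suc n) ^ k)"
    by (rule summable_comparison_test'[where N = 0])
      (use assms in \<open>auto intro!: divide_right_mono\<close>)
qed (use assms in auto)

text \<open>Tonelli: for nonnegative terms, summable fibre sums make the whole family summable, so
  \<open>infsum\<close> is a genuine value and not the default 0, and it may be computed
  fibrewise.\<close>

lemma sums_of_fibre_has_sum:
  fixes f :: "nat \<times> 'a \<Rightarrow> real"
  assumes "\<And>n. ((\<lambda>y. f (n, y)) has_sum g n) (B n)"
    and "\<And>x. f x \<ge> 0" and "g summable_on UNIV"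
  shows "g sums infsum f (Sigma UNIV B)"
proof -
  have "f summable_on Sigma UNIV B"
    by (rule summable_on_SigmaI[where g = g]) (use assms in auto)
  hence "(f has_sum infsum f (Sigma UNIV B)) (Sigma UNIV B)"
    by (rule has_sum_infsum)
  from has_sum_SigmaD[OF this assms(1)] show ?thesis
    by (intro has_sum_imp_sums)
qed

text \<open>\<open>Suc n\<close> is the index with exponent \<open>k\<close>, and \<open>i\<close>
  is its gap to the larger index, so the ordering constraint becomes a full product. The natural
  subtractions in the inverse map are exact because the entries decrease strictly and are
  positive.\<close>

lemma mzv2_eq_infsum:
  "mzv [s, k] = (\<Sum>\<^sub>\<infinity>(n, i)\<in>UNIV \<times> UNIV. 1 / real (Suc (i + Suc n)) ^ s / real (Suc n) ^ k)"
  unfolding mzv_def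
  by (rule sym, rule infsum_reindex_bij_witness[where
        j = "\<lambda>(n, i). [Suc (i + Suc n), Suc n]" and
        i = "\<lambda>ns. (ns ! 1 - 1, ns ! 0 - ns ! 1 - 1)"])
    (auto simp: mzv_indices_def length_Suc_conv eval_nat_numeral)

text \<open>Sorted by the middle index \<open>Suc n\<close>: the smaller index \<open>Suc l\<close>
  and the gap \<open>i\<close> to the larger one then vary independently, so each fibre sum
  factors.\<close>

lemma mzv3_eq_infsum:
  "mzv [s, k, t] = (\<Sum>\<^sub>\<infinity>(n, l, i)\<in>Sigma UNIV (\<lambda>n. {..<n} \<times> UNIV).
     1 / real (Suc l) ^ t * (1 / real (Suc (i + Suc n)) ^ s) / real (Suc n) ^ k)"
  unfolding mzv_def
  by (rule sym, rule infsum_reindex_bij_witness[where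
        j = "\<lambda>(n, l, i). [Suc (i + Suc n), Suc n, Suc l]" and
        i = "\<lambda>ns. (ns ! 1 - 1, ns ! 2 - 1, ns ! 0 - ns ! 1 - 1)"])
    (auto simp: mzv_indices_def length_Suc_conv eval_nat_numeral)

lemma zeta_tail_sums_mzv2:
  assumes "s > 1" "k > 1"
  shows "(\<lambda>n. (zeta s - zeta_partial (Suc n) s) / real (Suc n) ^ k) sums mzv [s, k]"
  unfolding mzv2_eq_infsum
proof (rule sums_of_fibre_has_sum)
  fix n
  show "((\<lambda>i. case (n, i) of (n, i) \<Rightarrow> 1 / real (Suc (i + Suc n)) ^ s / real (Suc n) ^ k)
      has_sum (zeta s - zeta_partial (Suc n) s) / real (Suc n) ^ k) UNIV"
    using has_sum_cmult_left[OF zeta_tail_has_sum[OF assms(1), of "Suc n"], of "1 / real (Suc n) ^ k"]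
    by simp
next
  show "(\<lambda>n. (zeta s - zeta_partial (Suc n) s) / real (Suc n) ^ k) summable_on UNIV"
    using assms zeta_partial_le_zeta[OF assms(1)] zeta_partial_nonneg[of _ s]
    by (intro summable_on_bounded_over_power[where C = "zeta s"]) auto
qed auto

lemma zeta_tail_times_partial_has_sum:
  assumes "s > 1"
  shows "((\<lambda>(l, i). 1 / real (Suc l) ^ t * (1 / real (Suc (i + N)) ^ s)) has_sum
           zeta_partial n t * (zeta s - zeta_partial N s)) ({..<n} \<times> UNIV)"
proof -
  have inner: "((\<lambda>i. case (l, i) of (l, i) \<Rightarrow> 1 / real (Suc l) ^ t * (1 / real (Suc (i + N)) ^ s)) has_sum
          1 / real (Suc l) ^ t * (zeta s - zeta_partial N s)) UNIV" for l
    unfolding prod.case by (rule has_sum_cmult_right[OF zeta_tail_has_sum[OF assms]])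
  show ?thesis
  proof (rule has_sum_SigmaI[OF inner])
    show "((\<lambda>l. 1 / real (Suc l) ^ t * (zeta s - zeta_partial N s)) has_sum
            zeta_partial n t * (zeta s - zeta_partial N s)) {..<n}"
      by (rule has_sum_finiteI) (auto simp: zeta_partial_eq_lessThan sum_distrib_right)
    show "(\<lambda>(l, i). 1 / real (Suc l) ^ t * (1 / real (Suc (i + N)) ^ s)) summable_on {..<n} \<times> UNIV"
      by (rule summable_on_SigmaI[OF inner]) auto
  qed
qed

lemma zeta_tail_times_partial_sums_mzv3:
  assumes "s > 1" "k > 1" "t > 1"
  \<comment> \<open>The partial sum stops at \<open>n\<close>, one short of the middle index
    \<open>Suc n\<close>, since the last index must be strictly smaller.\<close>
  shows "(\<lambda>n. zeta_partial n t * (zeta s - zeta_partial (Suc n) s) / real (Suc n) ^ k)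
           sums mzv [s, k, t]"
  unfolding mzv3_eq_infsum
proof (rule sums_of_fibre_has_sum)
  fix n
  show "((\<lambda>y. case (n, y) of (n, l, i) \<Rightarrow>
            1 / real (Suc l) ^ t * (1 / real (Suc (i + Suc n)) ^ s) / real (Suc n) ^ k)
      has_sum zeta_partial n t * (zeta s - zeta_partial (Suc n) s) / real (Suc n) ^ k)
      ({..<n} \<times> UNIV)"
    using has_sum_cmult_left[OF zeta_tail_times_partial_has_sum[OF assms(1), of t "Suc n" n],
        of "1 / real (Suc n) ^ k"]
    by (simp add: case_prod_unfold)
next
  show "(\<lambda>n. zeta_partial n t * (zeta s - zeta_partial (Suc n) s) / real (Suc n) ^ k)
          summable_on UNIV"
    using assms zeta_partial_le_zeta zeta_partial_nonneg zeta_nonneg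
    by (intro summable_on_bounded_over_power[where C = "zeta t * zeta s"])
      (auto intro!: mult_mono)
qed auto

text \<open>Extending the partial sum to \<open>Suc n\<close> adds the diagonal term, where the last
  two indices coincide and their exponents merge into \<open>t + k\<close>.\<close>

lemma zeta_tail_times_partial_sums:
  assumes "s > 1" "k > 1" "t > 1"
  shows "(\<lambda>n. zeta_partial (Suc n) t * (zeta s - zeta_partial (Suc n) s) / real (Suc n) ^ k)
           sums (mzv [s, k, t] + mzv [s, t + k])"
proof -
  have "(\<lambda>n. zeta_partial n t * (zeta s - zeta_partial (Suc n) s) / real (Suc n) ^ k
           + (zeta s - zeta_partial (Suc n) s) / real (Suc n) ^ (t + k))
          sums (mzv [s, k, t] + mzv [s, t + k])"
    using assms by (intro sums_add zeta_tail_times_partial_sums_mzv3 zeta_tail_sums_mzv2) auto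
  moreover have "zeta_partial (Suc n) t = zeta_partial n t + 1 / real (Suc n) ^ t" for n
    by (simp add: zeta_partial_def)
  ultimately show ?thesis
    by (simp add: power_add add_divide_distrib distrib_right)
qed

theorem theorem3p6:
  fixes m p q k :: nat
  assumes "m > 1" and "p > 1" and "q > 1" and "k > 1"
  shows "((\<lambda>n. (zeta m * zeta p - zeta_partial (Suc n) m * zeta_partial (Suc n) p) / real (Suc n) ^ k)
           sums (zeta p * mzv [m, k] + mzv [p, k, m] + mzv [p, m + k]))
         \<and> ((\<lambda>n. (zeta_partial (Suc n) m * zeta p * zeta q
                 - zeta m * zeta_partial (Suc n) p * zeta_partial (Suc n) q) / real (Suc n) ^ k)
           sums (zeta m * (zeta p * mzv [q, k] + mzv [p, k, q] + mzv [p, q + k])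
                 - zeta p * zeta q * mzv [m, k]))
         \<and> ((\<lambda>n. (zeta m * zeta_partial (Suc n) p * zeta_partial (Suc n) q
                 - zeta p * zeta_partial (Suc n) m * zeta_partial (Suc n) q) / real (Suc n) ^ k)
           sums (zeta p * (mzv [m, k, q] + mzv [m, q + k])
                 - zeta m * (mzv [p, k, q] + mzv [p, q + k])))"
proof -
  have first: "(\<lambda>n. (zeta a * zeta b - zeta_partial (Suc n) a * zeta_partial (Suc n) b) / real (Suc n) ^ k)
      sums (zeta b * mzv [a, k] + mzv [b, k, a] + mzv [b, a + k])" if "a > 1" "b > 1" for a b
    using sums_add[OF sums_mult[OF zeta_tail_sums_mzv2[OF \<open>a > 1\<close> \<open>k > 1\<close>], of "zeta b"]
        zeta_tail_times_partial_sums[OF \<open>b > 1\<close> \<open>k > 1\<close> \<open>a > 1\<close>]]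
    by (simp add: algebra_simps flip: add_divide_distrib)
  \<comment> \<open>The numerator is \<zeta>(m) times that of \<open>first\<close> for
    \<open>q\<close>, \<open>p\<close>, minus \<zeta>(p)\<zeta>(q) times the tail for
    \<open>m\<close>.\<close>
  have second: "(\<lambda>n. (zeta_partial (Suc n) m * zeta p * zeta q
                 - zeta m * zeta_partial (Suc n) p * zeta_partial (Suc n) q) / real (Suc n) ^ k)
           sums (zeta m * (zeta p * mzv [q, k] + mzv [p, k, q] + mzv [p, q + k])
                 - zeta p * zeta q * mzv [m, k])"
    using sums_diff[OF sums_mult[OF first[OF \<open>q > 1\<close> \<open>p > 1\<close>], of "zeta m"]
        sums_mult[OF zeta_tail_sums_mzv2[OF \<open>m > 1\<close> \<open>k > 1\<close>], of "zeta p * zeta q"]]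
    by (simp add: algebra_simps flip: diff_divide_distrib)
  \<comment> \<open>In \<zeta>(p) times the tail for \<open>m\<close> minus \<zeta>(m) times the
    tail for \<open>p\<close>, both multiplied by the partial sum for \<open>q\<close>, the products
    containing \<zeta>(m)\<zeta>(p) cancel.\<close>
  have third: "(\<lambda>n. (zeta m * zeta_partial (Suc n) p * zeta_partial (Suc n) q
                 - zeta p * zeta_partial (Suc n) m * zeta_partial (Suc n) q) / real (Suc n) ^ k)
           sums (zeta p * (mzv [m, k, q] + mzv [m, q + k])
                 - zeta m * (mzv [p, k, q] + mzv [p, q + k]))"
    using sums_diff[OF
        sums_mult[OF zeta_tail_times_partial_sums[OF \<open>m > 1\<close> \<open>k > 1\<close> \<open>q > 1\<close>], of "zeta p"]
        sums_mult[OF zeta_tail_times_partial_sums[OF \<open>p > 1\<close> \<open>k > 1\<close> \<open>q > 1\<close>], of "zeta m"]]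
    by (simp add: algebra_simps flip: diff_divide_distrib)
  show ?thesis
    using first[OF \<open>m > 1\<close> \<open>p > 1\<close>] second third by blast
qed

end
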